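(* Let $\mathcal{A} = (a_{i_1\cdots i_m})$ be a real symmetric tensor of order $m$ and dimension $n$ that is strictly copositive. Then the tensor complementarity problem TCP $(\mathbf{q}, \mathcal{A})$, namely finding $\mathbf{x} \in \mathbb{R}^n$ such that $$\mathbf{x} \geq \mathbf{0}, \quad \mathbf{q} + \mathcal{A}\mathbf{x}^{m-1} \geq \mathbf{0}, \quad \text{and} \quad \mathbf{x}^\top(\mathbf{q} + \mathcal{A}\mathbf{x}^{m-1}) = 0,$$ has a solution for all $\mathbf{q} \in \mathbb{R}^n$.
   Context: Let $I_n = \{1,2,\dots,n\}$. A real tensor of order $m$ and dimension $n$ is a multi-array $\mathcal{A} = (a_{i_1\cdots i_m})$ of real numbers with $i_j \in I_n$ for $j = 1,\dots,m$. It is symmetric if its entries $a_{i_1\cdots i_m}$ are invariant under any permutation of their indices. For $\mathbf{x} \in \mathbb{R}^n$, $\mathcal{A}\mathbf{x}^{m-1} \in \mathbb{R}^n$ is the vector with components $(\mathcal{A}\mathbf{x}^{m-1})_i = \sum_{i_2,\dots,i_m=1}^n a_{i i_2\cdots i_m} x_{i_2}\cdots x_{i_m}$, $i \in I_n$, and $\mathcal{A}\mathbf{x}^m = \mathbf{x}^\top(\mathcal{A}\mathbf{x}^{m-1}) = \sum_{i_1,\dots,i_m=1}^n a_{i_1\cdots i_m}x_{i_1}\cdots x_{i_m}$. Vector inequalities are componentwise: $\mathbf{x} \geq \mathbf{0}$ means $x_i \geq 0$ for all $i \in I_n$, and $\mathbb{R}^n_+ = \{\mathbf{x} \in \mathbb{R}^n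 : \mathbf{x} \geq \mathbf{0}\}$. $\mathcal{A}$ is strictly copositive if $\mathcal{A}\mathbf{x}^m > 0$ for all $\mathbf{x} \in \mathbb{R}^n_+ \setminus \{\mathbf{0}\}$.
   Formalization: The order m is assumed to be at least 2; for m = 1 the claim fails (n = 1, entry 1, q = -2: the tensor is strictly copositive but q + Ax^{m-1} = -1 < 0 for every x), and for m = 0 the vector Ax^{m-1} is undefined. *)

theory Defs
  imports "HOL-Analysis.Analysis" "HOL-Combinatorics.Permutations"
begin

text \<open>
  A tensor of order \<open>m\<close> and dimension \<open>CARD('n)\<close> maps a list of \<open>m\<close> indices
  \<open>[i\<^sub>1, \<dots>, i\<^sub>m]\<close> to an entry. The order is an explicit parameter of the notions below, which
  look only at index lists of the appropriate length; other values are junk.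
\<close>

type_synonym 'n tensor = "'n list \<Rightarrow> real"

definition symmetric_tensor :: "nat \<Rightarrow> 'n tensor \<Rightarrow> bool" where
  "symmetric_tensor m A \<longleftrightarrow>
     (\<forall>is \<pi>. length is = m \<longrightarrow> \<pi> permutes {..<m} \<longrightarrow> A (permute_list \<pi> is) = A is)"

text \<open>The vector written \<open>A x\<close> to the power \<open>m - 1\<close>; meaningful for \<open>m \<ge> 1\<close>.\<close>

definition tensor_vec :: "nat \<Rightarrow> 'n tensor \<Rightarrow> real ^ 'n \<Rightarrow> real ^ 'n" where
  "tensor_vec m A x =
     (\<chi> i. \<Sum>is | length is = m - 1. A (i # is) * (\<Prod>j\<leftarrow>is. x $ j))"

text \<open>The homogeneous form written \<open>A x\<close> to the power \<open>m\<close>.\<close>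

definition tensor_form :: "nat \<Rightarrow> 'n tensor \<Rightarrow> real ^ 'n \<Rightarrow> real" where
  "tensor_form m A x = (\<Sum>is | length is = m. A is * (\<Prod>j\<leftarrow>is. x $ j))"

lemma tensor_form_eq_inner:
  fixes x :: "real ^ 'n"
  assumes "m \<ge> 1"
  shows "tensor_form m A x = x \<bullet> tensor_vec m A x"
proof -
  obtain k where m: "m = Suc k"
    using assms by (cases m) auto
  have img: "{is :: 'n list. length is = Suc k} = (\<lambda>(i, js). i # js) ` (UNIV \<times> {js. length js = k})"
    by (auto simp: length_Suc_conv image_iff)
  have inj: "inj_on (\<lambda>(i, js). i # js) (UNIV \<times> {js :: 'n list. length js = k})"
    by (auto simp: inj_on_def)
  have "tensor_form m A x =
      (\<Sum>(i, js) \<in> UNIV \<times> {js. length js = k}. A (i # js) * (x $ i * (\<Prod>j\<leftarrow>js. x $ j)))"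
    unfolding tensor_form_def m img
    by (subst sum.reindex[OF inj]) (simp add: case_prod_unfold)
  also have "\<dots> = x \<bullet> tensor_vec m A x"
    by (simp add: m tensor_vec_def inner_vec_def sum.cartesian_product[symmetric]
        sum_distrib_left mult.left_commute)
  finally show ?thesis .
qed

definition strictly_copositive :: "nat \<Rightarrow> 'n::finite tensor \<Rightarrow> bool" where
  "strictly_copositive m A \<longleftrightarrow> (\<forall>x :: real ^ 'n. 0 \<le> x \<and> x \<noteq> 0 \<longrightarrow> tensor_form m A x > 0)"

definition tcp_solution :: "nat \<Rightarrow> real ^ 'n \<Rightarrow> 'n tensor \<Rightarrow> real ^ 'n \<Rightarrow> bool" where
  "tcp_solution m q A x \<longleftrightarrow>
     0 \<le> x \<and> 0 \<le> q + tensor_vec m A x \<and> x \<bullet> (q + tensor_vec m A x) = 0"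

end

theory Submission
  imports Defs
begin

text \<open>
  A continuous map \<open>F\<close> on a compact convex set \<open>K\<close> admits \<open>x \<in> K\<close> with
  \<open>F x \<bullet> (y - x) \<ge> 0\<close> for all \<open>y \<in> K\<close>: by Brouwer, the map that sends \<open>x\<close> to the projection of
  \<open>x - F x\<close> onto \<open>K\<close> has a fixed point. This is used for \<open>F x = q + tensor_vec m A x\<close> and for
  \<open>K\<close> the part of the nonnegative orthant inside a ball of radius \<open>r\<close>.

  It remains to see that the artificial constraint \<open>norm x \<le> r\<close> is inactive when \<open>r\<close> is large.
  Homogeneity and compactness improve strict copositivity to
  \<open>tensor_form m A x \<ge> c * norm x ^ m\<close> on the orthant for some \<open>c > 0\<close>
  (\<open>strictly_copositive_lower_bound\<close>). Testing the inequality with \<open>y = 0\<close> gives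
  \<open>tensor_form m A x \<le> - (q \<bullet> x) \<le> norm q * norm x\<close>, and since \<open>m \<ge> 2\<close> this bounds
  \<open>norm x\<close> independently of \<open>r\<close>. Then \<open>x\<close> may be moved a little in every direction pointing into
  the orthant, so the inequality holds for all these directions
  (\<open>complementarity_if_variational_inequality\<close>); the coordinate directions and \<open>x\<close>, \<open>- x\<close> yield
  exactly the complementarity conditions.
\<close>

lemma continuous_on_prod_list_components:
  "continuous_on S (\<lambda>x :: real ^ 'n. \<Prod>j\<leftarrow>is. x $ j)"
  by (induction "is") (auto intro!: continuous_intros)

lemma continuous_on_tensor_vec: "continuous_on S (tensor_vec m A)"
  unfolding tensor_vec_def
  by (intro continuous_on_vec_lambda continuous_on_sum continuous_on_mult
      continuous_on_const continuous_on_prod_list_components)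

lemma continuous_on_tensor_form: "continuous_on S (tensor_form m A)"
  unfolding tensor_form_def
  by (intro continuous_on_sum continuous_on_mult
      continuous_on_const continuous_on_prod_list_components)

lemma prod_list_components_scaleR:
  "(\<Prod>j\<leftarrow>is. (c *\<^sub>R x) $ j) = c ^ length is * (\<Prod>j\<leftarrow>is. (x :: real ^ 'n) $ j)"
  by (induction "is") (auto simp: algebra_simps)

lemma tensor_form_scaleR: "tensor_form m A (c *\<^sub>R x) = c ^ m * tensor_form m A x"
  unfolding tensor_form_def prod_list_components_scaleR sum_distrib_left
  by (rule sum.cong) auto

lemma closed_nonneg_orthant: "closed {x :: real ^ 'n. 0 \<le> x}"
  unfolding less_eq_vec_def
  by (intro closed_Collect_all closed_Collect_le continuous_intros)

lemma convex_nonneg_orthant: "convex {x :: real ^ 'n. 0 \<le> x}"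
  by (auto simp: convex_def less_eq_vec_def)

text \<open>
  The constant is the minimum of the form on the compact set of nonnegative unit vectors;
  homogeneity transports the bound to the whole orthant.
\<close>

lemma strictly_copositive_lower_bound:
  fixes A :: "'n::finite tensor"
  assumes "strictly_copositive m A" and "m > 0"
  obtains c where "c > 0"
    and "\<And>x :: real ^ 'n. 0 \<le> x \<Longrightarrow> c * norm x ^ m \<le> tensor_form m A x"
proof -
  let ?S = "sphere 0 1 \<inter> {x :: real ^ 'n. 0 \<le> x}"
  have "compact ?S"
    by (intro compact_Int_closed compact_sphere closed_nonneg_orthant)
  moreover have "axis undefined 1 \<in> ?S"
    by (simp add: less_eq_vec_def norm_axis_1) (simp add: axis_def)
  then have "?S \<noteq> {}"
    by blast
  ultimately obtain u where u: "u \<in> ?S"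
    and min: "\<And>v. v \<in> ?S \<Longrightarrow> tensor_form m A u \<le> tensor_form m A v"
    using continuous_attains_inf[of ?S, OF _ _ continuous_on_tensor_form[of ?S m A]] by blast
  show thesis
  proof
    from u have "u \<noteq> 0" and "0 \<le> u"
      by auto
    then show "tensor_form m A u > 0"
      using assms(1) by (auto simp: strictly_copositive_def)
  next
    fix x :: "real ^ 'n"
    assume x: "0 \<le> x"
    show "tensor_form m A u * norm x ^ m \<le> tensor_form m A x"
    proof (cases "x = 0")
      case True
      then show ?thesis
        using assms(2) tensor_form_scaleR[of m A 0 x] by (simp add: zero_power)
    next
      case False
      define v where "v = (1 / norm x) *\<^sub>R x"
      have "v \<in> ?S"
        using False x by (auto simp: v_def less_eq_vec_def)
      moreover have "x = norm x *\<^sub>R v"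
        using False by (simp add: v_def)
      ultimately show ?thesis
        using min[of v] tensor_form_scaleR[of m A "norm x" v]
        by (simp add: mult.commute mult_right_mono)
    qed
  qed
qed

text \<open>
  A fixed point \<open>x\<close> of the projection of \<open>x - F x\<close> is a solution, because the projection of a
  point \<open>z\<close> onto \<open>K\<close> is the point \<open>p\<close> of \<open>K\<close> at which \<open>z - p\<close> makes no acute angle with \<open>y - p\<close>
  for any \<open>y \<in> K\<close>.
\<close>

lemma variational_inequality_solvable:
  fixes F :: "'a::euclidean_space \<Rightarrow> 'a"
  assumes "compact K" "convex K" "K \<noteq> {}" and "continuous_on K F"
  obtains x where "x \<in> K" and "\<And>y. y \<in> K \<Longrightarrow> 0 \<le> F x \<bullet> (y - x)"
proof -
  have "closed K"
    using assms(1) by (rule compact_imp_closed)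
  let ?g = "\<lambda>x. closest_point K (x - F x)"
  have "continuous_on K ?g"
    by (rule continuous_on_compose2[OF continuous_on_closest_point[of K UNIV]])
      (use assms \<open>closed K\<close> in \<open>auto intro!: continuous_intros\<close>)
  moreover have "?g \<in> K \<rightarrow> K"
    using closest_point_in_set[OF \<open>closed K\<close> assms(3)] by auto
  ultimately obtain x where x: "x \<in> K" "?g x = x"
    by (rule brouwer[OF assms(1-3)])
  show thesis
  proof
    show "x \<in> K"
      by (fact x(1))
    show "0 \<le> F x \<bullet> (y - x)" if "y \<in> K" for y
      using closest_point_dot[OF assms(2) \<open>closed K\<close> that, of "x - F x"] x(2) by simp
  qed
qed

text \<open>
  A solution with \<open>norm x < r\<close> does not see the ball: any admissible direction \<open>d\<close> can be scaled
  down until \<open>x + t *\<^sub>R d\<close> stays inside, and the factor \<open>t > 0\<close> cancels in the inequality.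
\<close>

lemma complementarity_if_variational_inequality:
  fixes x w :: "real ^ 'n"
  assumes "0 \<le> x" and "norm x < r"
    and vi: "\<And>y. 0 \<le> y \<Longrightarrow> norm y \<le> r \<Longrightarrow> 0 \<le> w \<bullet> (y - x)"
  shows "0 \<le> w \<and> x \<bullet> w = 0"
proof -
  have direction: "0 \<le> w \<bullet> d" if d: "0 \<le> x + d" for d
  proof -
    define t where "t = min 1 ((r - norm x) / (norm d + 1))"
    have t: "0 < t" "t \<le> 1"
      using assms(2) by (auto simp: t_def add_nonneg_pos)
    have "t * norm d \<le> t * (norm d + 1)"
      using t by simp
    also have "\<dots> \<le> (r - norm x) / (norm d + 1) * (norm d + 1)"
      by (rule mult_right_mono) (auto simp: t_def)
    also have "\<dots> = r - norm x"
      using norm_ge_zero[of d] by (simp add: add_nonneg_eq_0_iff)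
    finally have "norm (x + t *\<^sub>R d) \<le> r"
      using norm_triangle_ineq[of x "t *\<^sub>R d"] t by simp
    moreover have "0 \<le> x + t *\<^sub>R d"
    proof -
      have "x + t *\<^sub>R d = (1 - t) *\<^sub>R x + t *\<^sub>R (x + d)"
        by (simp add: algebra_simps)
      then show ?thesis
        using convexD[OF convex_nonneg_orthant, of x "x + d" "1 - t" t] assms(1) d t by simp
    qed
    ultimately have "0 \<le> t * (w \<bullet> d)"
      using vi[of "x + t *\<^sub>R d"] by simp
    then show ?thesis
      using t(1) by (simp add: zero_le_mult_iff)
  qed
  have "0 \<le> w $ i" for i
  proof -
    have "0 \<le> x + axis i 1"
      using assms(1) by (simp add: less_eq_vec_def axis_def)
    then show ?thesis
      using direction[of "axis i 1"] by (simp add: inner_axis)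
  qed
  moreover have "x \<bullet> w = 0"
    using direction[of x] direction[of "- x"] assms(1)
    by (simp add: less_eq_vec_def inner_commute)
  ultimately show ?thesis
    by (simp add: less_eq_vec_def)
qed

theorem corollary3p5:
  fixes A :: "'n::finite tensor" and m :: nat
  assumes "m \<ge> 2"
    and "symmetric_tensor m A"
    and "strictly_copositive m A"
  shows "\<forall>q :: real ^ 'n. \<exists>x. tcp_solution m q A x"
proof
  fix q :: "real ^ 'n"
  obtain c where c: "c > 0"
    and growth: "\<And>x :: real ^ 'n. 0 \<le> x \<Longrightarrow> c * norm x ^ m \<le> tensor_form m A x"
    using strictly_copositive_lower_bound[OF assms(3)] assms(1) by auto
  \<comment> \<open>Chosen so that \<open>c * r > norm q\<close>, and \<open>r \<ge> 1\<close> makes \<open>r ^ m\<close> at least \<open>r ^ 2\<close>.\<close>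
  define r where "r = 1 + norm q / c"
  have r: "1 \<le> r" "norm q < c * r"
    using c by (auto simp: r_def field_simps)
  let ?F = "\<lambda>x. q + tensor_vec m A x"
  let ?K = "cball 0 r \<inter> {x :: real ^ 'n. 0 \<le> x}"
  have "0 \<in> ?K"
    using r(1) by simp
  have "compact ?K"
    by (intro compact_Int_closed compact_cball closed_nonneg_orthant)
  moreover have "convex ?K"
    by (intro convex_Int convex_cball convex_nonneg_orthant)
  moreover have "continuous_on ?K ?F"
    by (intro continuous_on_add continuous_on_const continuous_on_tensor_vec)
  ultimately obtain x where "x \<in> ?K" and vi: "\<And>y. y \<in> ?K \<Longrightarrow> 0 \<le> ?F x \<bullet> (y - x)"
    using variational_inequality_solvable[of ?K ?F] \<open>0 \<in> ?K\<close> by (metis empty_iff)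
  then have x: "0 \<le> x" "norm x \<le> r"
    by auto
  have "norm x \<noteq> r"
  proof
    assume "norm x = r"
    have "c * r * r \<le> c * norm x ^ m"
      using c r(1) power_increasing[OF assms(1) r(1)] \<open>norm x = r\<close>
      by (simp add: power2_eq_square mult.assoc)
    also have "\<dots> \<le> tensor_form m A x"
      using growth x(1) .
    also have "\<dots> \<le> - (q \<bullet> x)"
      using vi[OF \<open>0 \<in> ?K\<close>] tensor_form_eq_inner[of m A x] assms(1)
      by (simp add: inner_add_left inner_commute[of _ x] inner_add_right)
    also have "\<dots> \<le> norm q * r"
      using Cauchy_Schwarz_ineq2[of q x] \<open>norm x = r\<close> by simp
    also have "\<dots> < c * r * r"
      using r by simp
    finally show False
      by simp
  qed
  then have "0 \<le> ?F x \<and> x \<bullet> ?F x = 0"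
    using x vi by (intro complementarity_if_variational_inequality[where r = r]) auto
  then show "\<exists>x. tcp_solution m q A x"
    using x(1) by (auto simp: tcp_solution_def)
qed

end
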